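(* For every number of variables $n\ge 2$ and every even degree $d\ge 2$ there exists a homogeneous non-commutative polynomial $f$ of degree $d$ in the variables $x_1,\dots,x_n$, with nonnegative real coefficients, whose monotone ABP complexity is $B^+(f)=\Omega(d^2\log n)$ and whose (non-monotone) ABP complexity is $B(f)=O(d^2)$. (The constants implicit in $\Omega$ and $O$ are absolute, independent of $n$ and $d$.)
   Context: We work with non-commutative polynomials: a homogeneous polynomial of degree $d$ in $n$ variables is $f=\sum_{i_1,\dots,i_d\in[n]} c_{i_1\cdots i_d}\,x_{i_1}x_{i_2}\cdots x_{i_d}$, where the variables do not commute, so each of the $n^d$ ordered words $x_{i_1}\cdots x_{i_d}$ has its own coefficient. An algebraic branching program (ABP) of degree $d$ is a directed acyclic graph whose vertices are partitioned into levels $0,1,\dots,d$, with a single vertex (the source) at level $0$, a single vertex (the sink) at level $d$, and edges only from level $i$ to level $i+1$; each edge is labelled by a homogeneous linear form $\sum_i c_i x_i$ with real coefficients. The ABP computes the sum, over all source-to-sink paths, of the ordered (non-commutative) product of the edge labels along the path. The size of an ABP is its number of vertices. $B(f)$ is the minimum size of an ABP computing $f$. An ABP is monotone if all coefficients used in its edge labels are positive; $B^+(f)$ is the minimum size of a monotone ABP computing $f$. Logarithms are base 2. *)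

theory Defs
  imports Complex_Main "HOL-Library.Poly_Mapping" "Graph_Theory.Pair_Digraph"
begin

text \<open>
  Lists under concatenation form the free monoid, so that \<^typ>\<open>nat list \<Rightarrow>\<^sub>0 real\<close>, with the
  convolution product of \<^theory>\<open>HOL-Library.Poly_Mapping\<close>, is the free (non-commutative) algebra:
  the word \<open>[i\<^sub>1, \<dots>, i\<^sub>d]\<close> stands for the monomial \<open>x\<^bsub>i\<^sub>1\<^esub> \<cdots> x\<^bsub>i\<^sub>d\<^esub>\<close>.
\<close>

instantiation list :: (type) monoid_add
begin

definition zero_list :: "'a list" where
  "zero_list = []"

definition plus_list :: "'a list \<Rightarrow> 'a list \<Rightarrow> 'a list" where
  "plus_list xs ys = xs @ ys"

instance
  by standard (simp_all add: zero_list_def plus_list_def)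

end

type_synonym ncpoly = "nat list \<Rightarrow>\<^sub>0 real"

text \<open>As usual, the zero polynomial counts as homogeneous of every degree.\<close>

definition nc_homogeneous :: "nat \<Rightarrow> nat \<Rightarrow> ncpoly \<Rightarrow> bool" where
  "nc_homogeneous n d f \<longleftrightarrow>
     (\<forall>w \<in> Poly_Mapping.keys f. length w = d \<and> set w \<subseteq> {1..n})"

record 'v abp =
  dag :: "'v pair_pre_digraph"
  level :: "'v \<Rightarrow> nat"
  source :: 'v
  sink :: 'v
  label :: "'v \<times> 'v \<Rightarrow> ncpoly"

text \<open>Acyclicity is implied by the condition that every edge raises the level by one.\<close>

definition is_abp :: "nat \<Rightarrow> nat \<Rightarrow> 'v abp \<Rightarrow> bool" where
  "is_abp n d A \<longleftrightarrow>
     pair_fin_digraph (dag A) \<and>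
     (\<forall>v \<in> pverts (dag A). level A v \<le> d) \<and>
     {v \<in> pverts (dag A). level A v = 0} = {source A} \<and>
     {v \<in> pverts (dag A). level A v = d} = {sink A} \<and>
     (\<forall>(u, v) \<in> parcs (dag A). level A v = Suc (level A u)) \<and>
     (\<forall>e \<in> parcs (dag A). nc_homogeneous n 1 (label A e))"

definition abp_monotone :: "'v abp \<Rightarrow> bool" where
  "abp_monotone A \<longleftrightarrow>
     (\<forall>e \<in> parcs (dag A). \<forall>w \<in> Poly_Mapping.keys (label A e).
        0 < Poly_Mapping.lookup (label A e) w)"

definition abp_poly :: "'v abp \<Rightarrow> ncpoly" where
  "abp_poly A =
     (\<Sum>p | pre_digraph.apath (with_proj (dag A)) (source A) p (sink A).
        prod_list (map (label A) p))"

definition abp_size :: "'v abp \<Rightarrow> nat" where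
  "abp_size A = card (pverts (dag A))"

text \<open>
  ABPs are finite, so taking natural numbers as vertices is no restriction. The minimum is
  unspecified if there is no such ABP; this happens for no homogeneous polynomial in the general
  case, and for none with nonnegative coefficients in the monotone case, provided \<open>d \<ge> 1\<close>.
\<close>

definition abp_complexity :: "nat \<Rightarrow> nat \<Rightarrow> ncpoly \<Rightarrow> nat" where
  "abp_complexity n d f =
     (LEAST s. \<exists>A :: nat abp. is_abp n d A \<and> abp_poly A = f \<and> abp_size A = s)"

definition mono_abp_complexity :: "nat \<Rightarrow> nat \<Rightarrow> ncpoly \<Rightarrow> nat" where
  "mono_abp_complexity n d f =
     (LEAST s. \<exists>A :: nat abp. is_abp n d A \<and> abp_monotone A \<and> abp_poly A = f \<and> abp_size A = s)"

end

theory Submission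
  imports Defs "HOL-Library.Countable"
begin

text \<open>
  Take \<open>f\<close> with coefficient \<open>S(w)\<^sup>2\<close> at \<open>w\<close>, where \<open>S\<close> is an additive weight of the word \<open>w\<close>,
  antisymmetric under reversal, that reads a prefix of length \<open>k \<le> d/2\<close> as a base-\<open>n\<close> numeral.
  Carrying \<open>1, S, S\<^sup>2\<close> of the remaining suffix along, an ABP of width 3 computes \<open>f\<close>.
  On the other hand, completing each prefix \<open>u\<close> of length \<open>k\<close> to a palindrome \<open>u g(u)\<close> gives
  \<open>f(u g(u')) = 0\<close> exactly if \<open>u = u'\<close>. In a monotone ABP nothing cancels, so whether \<open>f(u v)\<close>
  vanishes depends on \<open>u\<close> only through the set of level-\<open>k\<close> vertices reachable along \<open>u\<close>. These
  sets are thus different for the \<open>n\<^sup>k\<close> prefixes, so that level has at least \<open>k log n\<close> vertices;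
  sum over \<open>k \<le> d/2\<close>.
\<close>

section \<open>Words, linear forms and their products\<close>

abbreviation coeff :: "ncpoly \<Rightarrow> nat list \<Rightarrow> real" where
  "coeff \<equiv> Poly_Mapping.lookup"

definition words :: "nat \<Rightarrow> nat \<Rightarrow> nat list set" where
  "words n k = {w. length w = k \<and> set w \<subseteq> {1..n}}"

lemma finite_words: "finite (words n k)"
  unfolding words_def using finite_lists_length_eq[of "{1..n}" k] by (simp add: conj_commute)

lemma card_words: "card (words n k) = n ^ k"
  unfolding words_def using card_lists_length_eq[of "{1..n}" k] by (simp add: conj_commute)

lemma words_Cons_iff: "i # w \<in> words n (Suc k) \<longleftrightarrow> i \<in> {1..n} \<and> w \<in> words n k"
  by (auto simp: words_def)

lemma words_0: "words n 0 = {[]}"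
  by (auto simp: words_def)

lemma nc_homogeneous_iff_coeff:
  "nc_homogeneous n d f \<longleftrightarrow> (\<forall>w. coeff f w \<noteq> 0 \<longrightarrow> w \<in> words n d)"
  by (auto simp: nc_homogeneous_def words_def in_keys_iff)

definition linear_form :: "nat \<Rightarrow> (nat \<Rightarrow> real) \<Rightarrow> ncpoly" where
  "linear_form n c = (\<Sum>i\<in>{1..n}. Poly_Mapping.single [i] (c i))"

lemma coeff_linear_form:
  "coeff (linear_form n c) w = (if w \<in> words n 1 then c (hd w) else 0)"
proof -
  have "coeff (linear_form n c) w = (\<Sum>i\<in>{1..n}. if w = [i] then c i else 0)"
    unfolding linear_form_def lookup_sum
    by (intro sum.cong refl) (auto simp: lookup_single when_def)
  also have "\<dots> = (if w \<in> words n 1 then c (hd w) else 0)"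
  proof (cases "w \<in> words n 1")
    case True
    then obtain j where "w = [j]" "j \<in> {1..n}"
      by (auto simp: words_def length_Suc_conv)
    then show ?thesis using True by simp
  next
    case False
    then have "\<forall>i\<in>{1..n}. w \<noteq> [i]" by (auto simp: words_def)
    then show ?thesis using False by auto
  qed
  finally show ?thesis .
qed

lemma nc_homogeneous_linear_form: "nc_homogeneous n 1 (linear_form n c)"
  unfolding nc_homogeneous_iff_coeff by (auto simp: coeff_linear_form)

text \<open>Only one-letter words occur in a linear form, so among all factorisations of
  \<open>i # w\<close> only the one that splits off the first letter contributes.\<close>

lemma coeff_linear_mult_Cons:
  assumes "nc_homogeneous n 1 l"
  shows "coeff (l * g) (i # w) = coeff l [i] * coeff g w"
proof -
  have *: "coeff l x * (\<Sum>q. coeff g q when i # w = x + q) =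
      (coeff l [i] * coeff g w when x = [i])" for x
  proof (cases "coeff l x = 0")
    case False
    then obtain j where x: "x = [j]"
      using assms by (auto simp: nc_homogeneous_iff_coeff words_def length_Suc_conv)
    have "(coeff g q when i # w = x + q) = ((coeff g q when j = i) when q = w)" for q
      by (auto simp: x plus_list_def when_def)
    then have "(\<Sum>q. coeff g q when i # w = x + q) = (coeff g w when j = i)" by simp
    then show ?thesis by (cases "j = i") (simp_all add: x)
  qed (auto simp: when_def)
  show ?thesis unfolding lookup_mult * by simp
qed

lemma coeff_linear_mult_Nil:
  assumes "nc_homogeneous n 1 l"
  shows "coeff (l * g) [] = 0"
proof (rule ccontr)
  assume "coeff (l * g) [] \<noteq> 0"
  then have "[] \<in> Poly_Mapping.keys (l * g)" by (simp add: in_keys_iff)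
  then obtain a b where "[] = a + b" "a \<in> Poly_Mapping.keys l"
    using keys_mult[of l g] by blast
  then show False
    using assms by (fastforce simp: nc_homogeneous_def plus_list_def)
qed

section \<open>Coefficients of an ABP by recursion on the first edge\<close>

text \<open>Generalises \<open>abp_poly\<close> to an arbitrary start vertex, which is what makes a
  recursion along the edges possible.\<close>

definition sink_poly :: "'v abp \<Rightarrow> 'v \<Rightarrow> ncpoly" where
  "sink_poly A u =
     (\<Sum>p | pre_digraph.apath (with_proj (dag A)) u p (sink A). prod_list (map (label A) p))"

lemma abp_poly_eq_sink_poly: "abp_poly A = sink_poly A (source A)"
  by (simp add: abp_poly_def sink_poly_def)

locale valid_abp =
  fixes n d :: nat and A :: "'v abp"
  assumes is_abp: "is_abp n d A"
begin

abbreviation "V \<equiv> pverts (dag A)"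
abbreviation "E \<equiv> parcs (dag A)"

sublocale pair_fin_digraph "dag A"
  using is_abp by (simp add: is_abp_def)

lemma level_le: "v \<in> V \<Longrightarrow> level A v \<le> d"
  and source_in: "source A \<in> V"
  and level_source: "level A (source A) = 0"
  and sink_in: "sink A \<in> V"
  and level_sink: "level A (sink A) = d"
  and eq_sink: "v \<in> V \<Longrightarrow> level A v = d \<Longrightarrow> v = sink A"
  and level_arc: "(u, v) \<in> E \<Longrightarrow> level A v = Suc (level A u)"
  and label_homogeneous: "(u, v) \<in> E \<Longrightarrow> nc_homogeneous n 1 (label A (u, v))"
  using is_abp by (auto simp: is_abp_def)

lemma finite_out: "finite {v. (u, v) \<in> E}"
  by (rule finite_subset[OF _ finite_imageI[OF pair_finite_arcs, of snd]]) force

lemma level_le_level_walk: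
  "pcas u p v \<Longrightarrow> set p \<subseteq> E \<Longrightarrow> x \<in> set (pawalk_verts u p) \<Longrightarrow> level A u \<le> level A x"
proof (induction p arbitrary: u)
  case (Cons e p)
  obtain y where e: "e = (u, y)" using Cons.prems by (cases e) auto
  show ?case
    using Cons.IH[of y] Cons.prems level_arc[of u y] by (auto simp: e)
qed auto

text \<open>The distinctness condition in \<open>apath\<close> is automatic: \<open>v\<close> lies
  strictly above \<open>u\<close> and levels never drop along a walk, so a walk from
  \<open>v\<close> cannot return to \<open>u\<close>.\<close>

lemma apath_Cons:
  "apath u (e # p) w \<longleftrightarrow> (\<exists>v. (u, v) \<in> E \<and> e = (u, v) \<and> apath v p w)"
proof -
  have "u \<notin> set (pawalk_verts v p)" if "(u, v) \<in> E" "apath v p w" for v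
    using level_le_level_walk[of v p w u] level_arc[OF that(1)] that(2)
    by (auto simp: apath_def awalk_def)
  then show ?thesis
    by (cases e) (auto simp: apath_Cons_iff)
qed

lemma sink_poly_sink: "sink_poly A (sink A) = 1"
proof -
  have "p = []" if "apath (sink A) p (sink A)" for p
    using apath_nonempty_ends[OF that] by auto
  then have "{p. apath (sink A) p (sink A)} = {[]}"
    using sink_in by (auto simp: apath_Nil_iff)
  then show ?thesis by (simp add: sink_poly_def)
qed

text \<open>Paths are sorted by their first edge; the classes are disjoint, and the label of that
  edge factors out on the left.\<close>

lemma sink_poly_rec:
  assumes "u \<noteq> sink A"
  shows "sink_poly A u = (\<Sum>v | (u, v) \<in> E. label A (u, v) * sink_poly A v)"
proof -
  let ?P = "\<lambda>v. {p. apath v p (sink A)}"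
  let ?f = "\<lambda>p. prod_list (map (label A) p)"
  have "?P u = (\<Union>v\<in>{v. (u, v) \<in> E}. (#) (u, v) ` ?P v)"
  proof (intro equalityI subsetI)
    fix p assume p: "p \<in> ?P u"
    then obtain e q where "p = e # q" using assms by (cases p) (auto simp: apath_Nil_iff)
    then show "p \<in> (\<Union>v\<in>{v. (u, v) \<in> E}. (#) (u, v) ` ?P v)" using p by (auto simp: apath_Cons)
  qed (auto simp: apath_Cons)
  then have "sink_poly A u = sum ?f (\<Union>v\<in>{v. (u, v) \<in> E}. (#) (u, v) ` ?P v)"
    by (simp add: sink_poly_def)
  also have "\<dots> = (\<Sum>v | (u, v) \<in> E. sum ?f ((#) (u, v) ` ?P v))"
    using finite_out apaths_finite by (intro sum.UNION_disjoint) auto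
  also have "\<dots> = (\<Sum>v | (u, v) \<in> E. label A (u, v) * sink_poly A v)"
    by (intro sum.cong refl)
      (subst sum.reindex, auto simp: sink_poly_def sum_distrib_left inj_on_def)
  finally show ?thesis .
qed

lemma no_arc_from_sink: "(sink A, v) \<notin> E"
  using level_arc[of "sink A" v] level_sink level_le[of v] in_arcsD2 by fastforce

lemma coeff_sink_poly_Nil: "coeff (sink_poly A u) [] = (if u = sink A then 1 else 0)"
proof (cases "u = sink A")
  case True
  then show ?thesis
    by (simp add: sink_poly_sink lookup_one zero_list_def)
next
  case False
  then show ?thesis
    by (auto simp: sink_poly_rec lookup_sum coeff_linear_mult_Nil[OF label_homogeneous]
        intro!: sum.neutral)
qed

text \<open>This includes the sink, where both sides vanish: its polynomial is \<open>1\<close>, and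
  no edge leaves it.\<close>

lemma coeff_sink_poly_Cons:
  "coeff (sink_poly A u) (i # w) =
     (\<Sum>v | (u, v) \<in> E. coeff (label A (u, v)) [i] * coeff (sink_poly A v) w)"
proof (cases "u = sink A")
  case True
  then show ?thesis
    by (simp add: sink_poly_sink lookup_one zero_list_def no_arc_from_sink)
next
  case False
  then show ?thesis
    by (auto simp: sink_poly_rec lookup_sum coeff_linear_mult_Cons[OF label_homogeneous]
        intro!: sum.cong)
qed

text \<open>Each edge consumes one letter and raises the level by one.\<close>

lemma coeff_sink_poly_nonzero:
  "coeff (sink_poly A u) w \<noteq> 0 \<Longrightarrow> w \<in> words n (d - level A u)"
proof (induction w arbitrary: u)
  case Nil
  then show ?case by (auto simp: coeff_sink_poly_Nil level_sink words_0 split: if_splits)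
next
  case (Cons i w)
  from Cons.prems obtain v where v: "(u, v) \<in> E" "coeff (label A (u, v)) [i] \<noteq> 0"
    "coeff (sink_poly A v) w \<noteq> 0"
    unfolding coeff_sink_poly_Cons by (auto elim!: sum.not_neutral_contains_not_neutral)
  have "i \<in> {1..n}"
    using v(2) label_homogeneous[OF v(1)] by (auto simp: nc_homogeneous_iff_coeff words_def)
  moreover have "d - level A u = Suc (d - level A v)"
    using level_arc[OF v(1)] level_le[OF in_arcsD2[OF v(1)]] by simp
  ultimately show ?case using Cons.IH[OF v(3)] by (simp add: words_Cons_iff)
qed

lemma nc_homogeneous_abp_poly: "nc_homogeneous n d (abp_poly A)"
  using coeff_sink_poly_nonzero[of "source A"]
  by (auto simp: nc_homogeneous_iff_coeff abp_poly_eq_sink_poly level_source)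

text \<open>A verification principle: a guessed closed form \<open>F\<close> for the coefficients is
  correct once it obeys the one-letter recursion and has value 1 at the sink.\<close>

lemma coeff_sink_poly_eqI:
  assumes "F (sink A) [] = 1"
    and "\<And>u i w. u \<in> V \<Longrightarrow> level A u < d \<Longrightarrow> i \<in> {1..n} \<Longrightarrow> w \<in> words n (d - Suc (level A u)) \<Longrightarrow>
      F u (i # w) = (\<Sum>v | (u, v) \<in> E. coeff (label A (u, v)) [i] * F v w)"
    and "u \<in> V" "w \<in> words n (d - level A u)"
  shows "coeff (sink_poly A u) w = F u w"
  using assms(3,4)
proof (induction w arbitrary: u)
  case Nil
  then have "level A u = d" using level_le[of u] by (auto simp: words_def)
  then show ?case using eq_sink Nil assms(1) by (auto simp: coeff_sink_poly_Nil)
next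
  case (Cons i w)
  then obtain k where k: "d - level A u = Suc k" by (cases "d - level A u") (auto simp: words_def)
  then have k': "level A u < d" "k = d - Suc (level A u)" by auto
  have "coeff (sink_poly A v) w = F v w" if "(u, v) \<in> E" for v
    using Cons k' level_arc[OF that] in_arcsD2[OF that] unfolding k by (auto simp: words_Cons_iff)
  then show ?case
    using assms(2)[of u i w] Cons.prems k' unfolding k words_Cons_iff
    by (simp add: coeff_sink_poly_Cons)
qed

end

section \<open>Reachability, monotonicity and the fooling set bound\<close>

text \<open>The ABP read as a nondeterministic automaton: coefficients are only tested for being
  nonzero, and their values are forgotten.\<close>

fun reach :: "'v abp \<Rightarrow> 'v \<Rightarrow> nat list \<Rightarrow> 'v set" where
  "reach A u [] = {u}"
| "reach A u (i # w) =
     (\<Union>v\<in>{v. (u, v) \<in> parcs (dag A) \<and> coeff (label A (u, v)) [i] \<noteq> 0}. reach A v w)"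

context valid_abp
begin

lemma reach_subset:
  "u \<in> V \<Longrightarrow> reach A u w \<subseteq> {v \<in> V. level A v = level A u + length w}"
proof (induction w arbitrary: u)
  case (Cons i w)
  then show ?case using level_arc in_arcsD2 by fastforce
qed auto

end

locale monotone_abp = valid_abp +
  assumes monotone: "abp_monotone A"
begin

lemma coeff_label_nonneg: "(u, v) \<in> E \<Longrightarrow> 0 \<le> coeff (label A (u, v)) w"
  using monotone by (cases "coeff (label A (u, v)) w = 0")
    (auto simp: abp_monotone_def in_keys_iff intro: less_imp_le)

lemma coeff_sink_poly_nonneg: "0 \<le> coeff (sink_poly A u) w"
proof (induction w arbitrary: u)
  case Nil
  show ?case by (simp add: coeff_sink_poly_Nil)
next
  case (Cons i w)
  then show ?case
    by (auto simp: coeff_sink_poly_Cons intro!: sum_nonneg mult_nonneg_nonneg coeff_label_nonneg)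
qed

text \<open>All terms of the recursion are nonnegative, so a sum vanishes only if every term does.
  Hence the prefix \<open>v\<close> matters only through its reachable set.\<close>

lemma coeff_sink_poly_append_eq_0_iff:
  "coeff (sink_poly A u) (v @ w) = 0 \<longleftrightarrow> (\<forall>x\<in>reach A u v. coeff (sink_poly A x) w = 0)"
proof (induction v arbitrary: u)
  case (Cons i v)
  have "coeff (sink_poly A u) (i # v @ w) = 0 \<longleftrightarrow>
      (\<forall>x\<in>{x. (u, x) \<in> E}. coeff (label A (u, x)) [i] * coeff (sink_poly A x) (v @ w) = 0)"
    unfolding coeff_sink_poly_Cons
    by (rule sum_nonneg_eq_0_iff)
      (auto intro: finite_out mult_nonneg_nonneg coeff_label_nonneg coeff_sink_poly_nonneg)
  then show ?case using Cons.IH by auto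
qed simp

text \<open>If \<open>u\<close> and \<open>u'\<close> had the same reachable set, the coefficients
  at \<open>u @ g u'\<close> and \<open>u' @ g u'\<close> would vanish together. So
  \<open>reach\<close> embeds \<open>U\<close> into the subsets of level \<open>k\<close>.\<close>

lemma card_level_ge_fooling_set:
  assumes length: "\<And>u. u \<in> U \<Longrightarrow> length u = k"
    and diag: "\<And>u. u \<in> U \<Longrightarrow> coeff (abp_poly A) (u @ g u) = 0"
    and off_diag: "\<And>u u'. u \<in> U \<Longrightarrow> u' \<in> U \<Longrightarrow> u \<noteq> u' \<Longrightarrow> coeff (abp_poly A) (u @ g u') \<noteq> 0"
  shows "card U \<le> 2 ^ card {v \<in> V. level A v = k}"
proof -
  let ?L = "{v \<in> V. level A v = k}"
  have fin: "finite ?L" using pair_finite_verts by simp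
  have "inj_on (reach A (source A)) U"
  proof (rule inj_onI, rule ccontr)
    fix u u' assume *: "u \<in> U" "u' \<in> U" "reach A (source A) u = reach A (source A) u'" "u \<noteq> u'"
    then show False
      using diag[of u'] off_diag[of u u']
      by (simp add: abp_poly_eq_sink_poly coeff_sink_poly_append_eq_0_iff)
  qed
  moreover have "reach A (source A) ` U \<subseteq> Pow ?L"
    using reach_subset[OF source_in] length by (fastforce simp: level_source)
  ultimately have "card U \<le> card (Pow ?L)"
    using fin by (intro card_inj_on_le) auto
  then show ?thesis using fin by (simp add: card_Pow)
qed

end

section \<open>ABPs built from complete layers\<close>

text \<open>All pairs on consecutive levels are joined; an absent edge is encoded by the zero form,
  which \<open>abp_monotone\<close> admits because it constrains only nonzero coefficients.\<close>

definition layered_abp ::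
    "nat \<Rightarrow> 'v set \<Rightarrow> ('v \<Rightarrow> nat) \<Rightarrow> 'v \<Rightarrow> 'v \<Rightarrow> ('v \<Rightarrow> 'v \<Rightarrow> nat \<Rightarrow> real) \<Rightarrow> 'v abp" where
  "layered_abp n V lev s t c =
     \<lparr>dag = \<lparr>pverts = V, parcs = {(u, v). u \<in> V \<and> v \<in> V \<and> lev v = Suc (lev u)}\<rparr>,
      level = lev, source = s, sink = t, label = (\<lambda>(u, v). linear_form n (c u v))\<rparr>"

locale layered =
  fixes n d :: nat and V :: "'v set" and lev :: "'v \<Rightarrow> nat" and s t :: 'v
    and c :: "'v \<Rightarrow> 'v \<Rightarrow> nat \<Rightarrow> real"
  assumes finite_vertices: "finite V"
    and lev_le: "\<And>v. v \<in> V \<Longrightarrow> lev v \<le> d"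
    and lev_eq_0: "{v \<in> V. lev v = 0} = {s}"
    and lev_eq_d: "{v \<in> V. lev v = d} = {t}"
begin

abbreviation "L \<equiv> layered_abp n V lev s t c"

lemma is_abp_layered: "is_abp n d L"
proof -
  have "finite {(u, v). u \<in> V \<and> v \<in> V \<and> lev v = Suc (lev u)}"
    by (rule finite_subset[of _ "V \<times> V"]) (auto simp: finite_vertices)
  then have "pair_fin_digraph (dag L)"
    using finite_vertices by unfold_locales (auto simp: layered_abp_def)
  then show ?thesis
    using lev_le lev_eq_0 lev_eq_d nc_homogeneous_linear_form
    by (auto simp: is_abp_def layered_abp_def)
qed

lemma abp_monotone_layered:
  assumes "\<And>u v i. 0 \<le> c u v i"
  shows "abp_monotone L"
  using assms
  by (auto simp: abp_monotone_def layered_abp_def in_keys_iff coeff_linear_form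
      intro: order.not_eq_order_implies_strict split: if_splits)

lemma coeff_abp_poly_layeredI:
  assumes "F t [] = 1"
    and step: "\<And>u i w. u \<in> V \<Longrightarrow> lev u < d \<Longrightarrow> i \<in> {1..n} \<Longrightarrow> w \<in> words n (d - Suc (lev u)) \<Longrightarrow>
      F u (i # w) = (\<Sum>v | v \<in> V \<and> lev v = Suc (lev u). c u v i * F v w)"
    and "w \<in> words n d"
  shows "coeff (abp_poly L) w = F s w"
proof -
  interpret valid_abp n d L by standard (rule is_abp_layered)
  have "coeff (sink_poly L (source L)) w = F (source L) w"
  proof (rule coeff_sink_poly_eqI)
    fix u i w
    assume u: "u \<in> pverts (dag L)" "level L u < d" "i \<in> {1..n}" "w \<in> words n (d - Suc (level L u))"
    have "F u (i # w) = (\<Sum>v | v \<in> V \<and> lev v = Suc (lev u). c u v i * F v w)"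
      using u by (intro step) (auto simp: layered_abp_def)
    also have "\<dots> = (\<Sum>v | (u, v) \<in> parcs (dag L). coeff (label L (u, v)) [i] * F v w)"
      using u by (intro sum.cong) (auto simp: layered_abp_def coeff_linear_form words_def)
    finally show "F u (i # w) = \<dots>" .
  qed (use assms source_in level_source in \<open>auto simp: layered_abp_def\<close>)
  then show ?thesis by (simp add: abp_poly_eq_sink_poly layered_abp_def)
qed

lemma abp_size_layered: "abp_size L = card V"
  by (simp add: abp_size_def layered_abp_def)

end

text \<open>
  The prefix tree of all words, with the words of length \<open>d\<close> merged into the sink. It shows that the
  minimum defining the monotone complexity is not taken over the empty set.
\<close>

lemma ex_monotone_abp:
  assumes d: "0 < d" and hom: "nc_homogeneous n d f" and nonneg: "\<And>w. 0 \<le> coeff f w"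
  shows "\<exists>A :: nat abp. is_abp n d A \<and> abp_monotone A \<and> abp_poly A = f"
proof -
  \<comment> \<open>The level of a vertex is the length of the list that it encodes, so the sink is
    represented by a list of length \<open>d\<close>.\<close>
  let ?t = "replicate d (0 :: nat)"
  define V :: "nat set" where "V = to_nat ` ((\<Union>k<d. words n k) \<union> {?t})"
  define lev :: "nat \<Rightarrow> nat" where "lev v = length (from_nat v :: nat list)" for v
  \<comment> \<open>Edges inside the tree carry 1 at the letter being appended; the coefficients of
    \<open>f\<close> enter only on the edges into the sink.\<close>
  define c where "c u v i = (if lev v < d then if from_nat v = from_nat u @ [i] then 1 else 0
      else coeff f (from_nat u @ [i]))" for u v :: nat and i :: nat
  interpret layered n d V lev "to_nat ([] :: nat list)" "to_nat ?t" c
  proof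
    show "finite V"
      unfolding V_def by (intro finite_imageI finite_UnI finite_UN_I finite_words) auto
    show "{v \<in> V. lev v = 0} = {to_nat ([] :: nat list)}"
      using d by (auto simp: V_def lev_def words_def)
    show "{v \<in> V. lev v = d} = {to_nat ?t}"
      by (auto simp: V_def lev_def words_def)
  qed (auto simp: V_def lev_def words_def)
  define F where "F u w = (if lev u = d then 1 else coeff f (from_nat u @ w))" for u w
  have "coeff (abp_poly L) w = coeff f w" if "w \<in> words n d" for w
  proof -
    have "coeff (abp_poly L) w = F (to_nat ([] :: nat list)) w"
      using _ _ that
    proof (rule coeff_abp_poly_layeredI)
      fix u i w
      assume u: "u \<in> V" "lev u < d" and i: "i \<in> {1..n}" and w: "w \<in> words n (d - Suc (lev u))"
      from u obtain x where x: "u = to_nat x" "x \<in> words n (lev u)"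
        by (auto simp: V_def lev_def words_def)
      have Fu: "F u (i # w) = coeff f (x @ i # w)"
        using u x by (auto simp: F_def)
      show "F u (i # w) = (\<Sum>v | v \<in> V \<and> lev v = Suc (lev u). c u v i * F v w)"
      proof (cases "Suc (lev u) < d")
        case True
        then have "{v \<in> V. lev v = Suc (lev u)} = to_nat ` words n (Suc (lev u))"
          by (auto simp: V_def lev_def words_def)
        then have "(\<Sum>v | v \<in> V \<and> lev v = Suc (lev u). c u v i * F v w) =
            (\<Sum>y\<in>words n (Suc (lev u)). c u (to_nat y) i * F (to_nat y) w)"
          by (simp add: sum.reindex)
        also have "\<dots> = (\<Sum>y\<in>words n (Suc (lev u)). if y = x @ [i] then coeff f (x @ i # w) else 0)"
        proof (rule sum.cong[OF refl])
          fix y assume "y \<in> words n (Suc (lev u))"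
          then have "lev (to_nat y) = Suc (lev u)" by (simp add: lev_def words_def)
          then show "c u (to_nat y) i * F (to_nat y) w =
              (if y = x @ [i] then coeff f (x @ i # w) else 0)"
            using True x(1) by (simp add: c_def F_def)
        qed
        also have "\<dots> = coeff f (x @ i # w)"
        proof -
          have "x @ [i] \<in> words n (Suc (lev u))"
            using x(2) i by (auto simp: words_def)
          then show ?thesis by (simp add: finite_words)
        qed
        finally show ?thesis by (simp add: Fu)
      next
        case False
        then have d': "d = Suc (lev u)" using u by simp
        have "{v \<in> V. lev v = Suc (lev u)} = {to_nat ?t}"
          using lev_eq_d unfolding d' .
        moreover have "w = []" using w by (simp add: d' words_def)
        moreover have "lev (to_nat ?t) = d" by (simp add: lev_def)
        ultimately show ?thesis
          using Fu by (simp add: F_def c_def x(1)[symmetric]) (simp add: x(1))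
      qed
    qed (auto simp: F_def lev_def)
    then show ?thesis using d by (simp add: F_def lev_def)
  qed
  moreover have "nc_homogeneous n d (abp_poly L)"
  proof -
    interpret valid_abp n d L by standard (rule is_abp_layered)
    show ?thesis by (rule nc_homogeneous_abp_poly)
  qed
  \<comment> \<open>Both polynomials are homogeneous of degree \<open>d\<close>, so agreement on
    \<open>words n d\<close> suffices.\<close>
  ultimately have "abp_poly L = f"
    using hom by (intro poly_mapping_eqI) (metis nc_homogeneous_iff_coeff)
  moreover have "abp_monotone L"
    using nonneg by (intro abp_monotone_layered) (simp add: c_def)
  ultimately show ?thesis using is_abp_layered by blast
qed

section \<open>Weighted sums of words and an ABP for their squares\<close>

text \<open>The offset \<open>k\<close> is the position of the first letter of \<open>w\<close> in
  the whole word, so a suffix keeps its weights.\<close>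

definition weighted_sum :: "(nat \<Rightarrow> nat \<Rightarrow> real) \<Rightarrow> nat \<Rightarrow> nat list \<Rightarrow> real" where
  "weighted_sum a k w = (\<Sum>j<length w. a (k + j) (w ! j))"

lemma weighted_sum_Nil [simp]: "weighted_sum a k [] = 0"
  by (simp add: weighted_sum_def)

lemma weighted_sum_Cons [simp]:
  "weighted_sum a k (i # w) = a k i + weighted_sum a (Suc k) w"
  unfolding weighted_sum_def list.size(4) add_Suc_right add_0_right
  by (subst sum.lessThan_Suc_shift) simp

lemma weighted_sum_append:
  "weighted_sum a k (u @ v) = weighted_sum a k u + weighted_sum a (k + length u) v"
  by (induction u arbitrary: k) auto

text \<open>
  The vertex \<open>3 * k + j\<close> stands for the \<open>j\<close>-th power of the weighted sum of a suffix starting at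
  position \<open>k\<close>; the edges expand \<open>(a + S)\<^sup>j\<close> by the binomial theorem. The source is \<open>2\<close>.
\<close>

lemma ex_square_abp:
  assumes d: "0 < d"
  shows "\<exists>A :: nat abp. is_abp n d A \<and> abp_size A \<le> 3 * d + 1 \<and>
    (\<forall>w\<in>words n d. coeff (abp_poly A) w = (weighted_sum a 0 w)\<^sup>2)"
proof -
  \<comment> \<open>Starting at 2 leaves only the second power on level 0; stopping at
    \<open>3 * d\<close> leaves only the zeroth power on level \<open>d\<close>, where the empty
    suffix gives 1.\<close>
  define V :: "nat set" where "V = {2..3 * d}"
  have d2: "2 \<le> 3 * d" using d by linarith
  define c where "c u v i = real ((u mod 3) choose (v mod 3)) * a (u div 3) i ^ (u mod 3 - v mod 3)"
    for u v i :: nat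
  interpret layered n d V "\<lambda>v. v div 3" 2 "3 * d" c
  proof
    show "{v \<in> V. v div 3 = 0} = {2}"
      using d by (auto simp: V_def)
    show "{v \<in> V. v div 3 = d} = {3 * d}"
      using d2 by (auto simp: V_def)
  qed (auto simp: V_def)
  define F where "F u w = weighted_sum a (u div 3) w ^ (u mod 3)" for u w
  have "coeff (abp_poly L) w = F 2 w" if "w \<in> words n d" for w
    using _ _ that
  proof (rule coeff_abp_poly_layeredI)
    fix u i w
    assume u: "u \<in> V" "u div 3 < d" and i: "i \<in> {1..n}" and w: "w \<in> words n (d - Suc (u div 3))"
    define k j where "k = u div 3" and "j = u mod 3"
    have c: "c u v i = real (j choose (v mod 3)) * a k i ^ (j - v mod 3)" for v
      by (simp add: c_def k_def j_def)
    have F: "F u (i # w) = (a k i + weighted_sum a (Suc k) w) ^ j"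
      by (simp add: F_def k_def j_def)
    show "F u (i # w) = (\<Sum>v | v \<in> V \<and> v div 3 = Suc (u div 3). c u v i * F v w)"
    proof (cases "Suc k = d")
      case True
      \<comment> \<open>The remaining sum is empty, so the binomial expansion reduces to its term
        for exponent 0, the only one with a vertex on the last level.\<close>
      then have "w = []" using w by (simp add: words_def k_def)
      moreover have "{v. v \<in> V \<and> v div 3 = Suc k} = {3 * d}"
        unfolding V_def True using d2 by auto
      ultimately show ?thesis
        unfolding F c k_def[symmetric] by (simp add: F_def)
    next
      case False
      then have "Suc k < d" using u by (simp add: k_def)
      then have *: "{v. v \<in> V \<and> v div 3 = Suc k} = (\<lambda>l. l + 3 * Suc k) ` {..<3}"
      proof (intro equalityI subsetI)
        fix v assume "v \<in> {v. v \<in> V \<and> v div 3 = Suc k}"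
        then have "v = v mod 3 + 3 * Suc k" by (metis (mono_tags) mem_Collect_eq mod_mult_div_eq)
        then show "v \<in> (\<lambda>l. l + 3 * Suc k) ` {..<3}" by (rule image_eqI) simp
      qed (auto simp: V_def)
      have "(\<Sum>v | v \<in> V \<and> v div 3 = Suc k. c u v i * F v w) =
          (\<Sum>l<3. real (j choose l) * a k i ^ (j - l) * weighted_sum a (Suc k) w ^ l)"
        unfolding * c F_def
        by (subst sum.reindex) (auto simp: inj_on_def mod_mult_self2 div_mult_self2
            simp del: mult_Suc mult_Suc_right intro!: sum.cong)
      \<comment> \<open>The binomial coefficient vanishes for \<open>l > j\<close>: no edge raises
        the exponent.\<close>
      also have "\<dots> = (\<Sum>l\<le>j. real (j choose l) * a k i ^ (j - l) * weighted_sum a (Suc k) w ^ l)"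
        by (rule sum.mono_neutral_right) (auto simp: j_def)
      also have "\<dots> = F u (i # w)"
        unfolding F add.commute[of "a k i"] binomial_ring by (simp add: mult_ac)
      finally show ?thesis by (simp add: k_def)
    qed
  qed (simp add: F_def)
  moreover have "abp_size L \<le> 3 * d + 1"
    using abp_size_layered by (simp add: V_def)
  ultimately show ?thesis
    using is_abp_layered by (intro exI[of _ L]) (auto simp: F_def)
qed

section \<open>Palindromes and injectivity of the weight on prefixes\<close>

text \<open>\<open>S\<close> is \<^term>\<open>weighted_sum (palindromic_weight n d) 0\<close>.\<close>

definition palindromic_weight :: "nat \<Rightarrow> nat \<Rightarrow> nat \<Rightarrow> nat \<Rightarrow> real" where
  "palindromic_weight n d j i =
     (if j < d div 2 then real (n ^ j * i) else - real (n ^ (d - Suc j) * i))"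

text \<open>Mirror positions \<open>j\<close> and \<open>d - Suc j\<close> carry equal letters with
  opposite weights, so reversing the order of summation shows that the sum is its own
  negative.\<close>

lemma weighted_sum_palindrome:
  assumes "even d" "length w = d" "rev w = w"
  shows "weighted_sum (palindromic_weight n d) 0 w = 0"
proof -
  let ?g = "\<lambda>j. palindromic_weight n d j (w ! j)"
  have "?g (d - Suc j) = - ?g j" if "j < d" for j
  proof -
    have "w ! (d - Suc j) = w ! j"
      using that assms by (metis rev_nth)
    moreover have "d - Suc j < d div 2 \<longleftrightarrow> \<not> j < d div 2"
      using that assms by (auto elim!: evenE)
    ultimately show ?thesis using that by (auto simp: palindromic_weight_def)
  qed
  then have "(\<Sum>j<d. ?g j) = (\<Sum>j<d. - ?g j)"
    by (subst sum.nat_diff_reindex[symmetric]) simp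
  then show ?thesis by (simp add: weighted_sum_def assms(2) sum_negf)
qed

text \<open>These are base-\<open>n\<close> numerals with digits 1 to \<open>n\<close>, least
  significant first. The residue modulo \<open>n\<close> determines the first digit, and induction
  handles the rest.\<close>

lemma digit_sum_inj:
  fixes n :: nat
  assumes "u \<in> words n k" "v \<in> words n k" "(\<Sum>j<k. n ^ j * u ! j) = (\<Sum>j<k. n ^ j * v ! j)"
  shows "u = v"
  using assms
proof (induction k arbitrary: u v)
  case 0
  then show ?case by (simp add: words_0)
next
  case (Suc k)
  obtain x u' where u: "u = x # u'" "x \<in> {1..n}" "u' \<in> words n k"
    using Suc.prems(1) by (cases u) (auto simp: words_def)
  obtain y v' where v: "v = y # v'" "y \<in> {1..n}" "v' \<in> words n k"
    using Suc.prems(2) by (cases v) (auto simp: words_def)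
  let ?S = "\<lambda>w. \<Sum>j<k. n ^ j * w ! j"
  have "(\<Sum>j<Suc k. n ^ j * (z # w) ! j) = z + n * ?S w" for z w
    by (subst sum.lessThan_Suc_shift) (simp add: sum_distrib_left mult.assoc)
  then have eq: "x + n * ?S u' = y + n * ?S v'"
    using Suc.prems(3) u v by simp
  \<comment> \<open>Shifting the digits to the range from 0 to \<open>n - 1\<close> makes them
    remainders modulo \<open>n\<close>.\<close>
  then have "(x - 1) + n * ?S u' = (y - 1) + n * ?S v'"
    using u(2) v(2) by simp
  then have "((x - 1) + n * ?S u') mod n = ((y - 1) + n * ?S v') mod n" by simp
  moreover have "x - 1 < n" "y - 1 < n" using u(2) v(2) by auto
  ultimately have "x - 1 = y - 1" by simp
  then have "x = y" using u(2) v(2) unfolding atLeastAtMost_iff by arith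
  then have "?S u' = ?S v'" using eq u(2) by simp
  then show ?case using Suc.IH u v \<open>x = y\<close> by simp
qed

lemma weighted_sum_prefix_inj:
  assumes "k \<le> d div 2" "u \<in> words n k" "v \<in> words n k"
    and "weighted_sum (palindromic_weight n d) 0 u = weighted_sum (palindromic_weight n d) 0 v"
  shows "u = v"
proof -
  have "weighted_sum (palindromic_weight n d) 0 w = real (\<Sum>j<k. n ^ j * w ! j)" if "w \<in> words n k" for w
    using that assms(1) by (simp add: weighted_sum_def palindromic_weight_def words_def)
  then show ?thesis using digit_sum_inj[of u n k v] assms by (simp only: of_nat_eq_iff)
qed

section \<open>The complexity bounds\<close>

lemma (in monotone_abp) size_ge:
  assumes n: "2 \<le> n" and even: "even d"
    and poly: "\<And>w. w \<in> words n d \<Longrightarrow>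
      coeff (abp_poly A) w = (weighted_sum (palindromic_weight n d) 0 w)\<^sup>2"
  shows "real d ^ 2 * log 2 n \<le> 8 * real (abp_size A)"
proof -
  define m where "m = d div 2"
  have d: "d = 2 * m" using even by (simp add: m_def)
  let ?S = "weighted_sum (palindromic_weight n d) 0"
  let ?l = "\<lambda>k. card {v \<in> V. level A v = k}"
  have level: "real k * log 2 n \<le> real (?l k)" if k: "k \<le> m" for k
  proof -
    \<comment> \<open>The prefix \<open>u\<close> is padded with the letter 1 to length
      \<open>m\<close> and then reflected, so that \<open>u @ g u\<close> is a palindrome of length
      \<open>d\<close>.\<close>
    define g where "g u = replicate (m - k) 1 @ rev (u @ replicate (m - k) 1)" for u :: "nat list"
    have g: "u @ g u' \<in> words n d" if "u \<in> words n k" "u' \<in> words n k" for u u'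
      using that k n by (auto simp: g_def words_def d)
    have zero: "?S (u @ g u) = 0" if "u \<in> words n k" for u
      using that k even by (intro weighted_sum_palindrome) (auto simp: g_def words_def d)
    have "?S (u @ g u') = 0 \<longleftrightarrow> u = u'" if "u \<in> words n k" "u' \<in> words n k" for u u'
    proof
      assume "?S (u @ g u') = 0"
      then have "?S u = ?S u'"
        \<comment> \<open>The words \<open>u @ g u'\<close> and \<open>u' @ g u'\<close> share
          everything from position \<open>k\<close> on, and the second has weight 0.\<close>
        using zero[OF that(2)] that by (simp add: weighted_sum_append words_def)
      then show "u = u'"
        using weighted_sum_prefix_inj[of k d u n u'] that k by (simp add: m_def)
    qed (use zero that in simp)
    then have "card (words n k) \<le> 2 ^ ?l k"
      using g by (intro card_level_ge_fooling_set[where g = g]) (auto simp: poly words_def)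
    then have "real n ^ k \<le> 2 ^ ?l k"
      unfolding card_words by (metis of_nat_le_iff of_nat_numeral of_nat_power)
    then have "log 2 (real n ^ k) \<le> log 2 (2 ^ ?l k)"
      using n by (intro log_mono) auto
    then show ?thesis using n by (simp add: log_nat_power)
  qed
  have "(\<Sum>k\<le>m. ?l k) = card (\<Union>k\<le>m. {v \<in> V. level A v = k})"
    using pair_finite_verts by (intro card_UN_disjoint[symmetric]) auto
  also have "\<dots> \<le> abp_size A"
    unfolding abp_size_def using pair_finite_verts by (intro card_mono) auto
  finally have "real (\<Sum>k\<le>m. ?l k) \<le> real (abp_size A)" by (rule of_nat_mono)
  moreover have "(\<Sum>k\<le>m. real k * log 2 n) \<le> real (\<Sum>k\<le>m. ?l k)"
    unfolding of_nat_sum by (intro sum_mono level) simp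
  moreover have "(\<Sum>k\<le>m. real k * log 2 n) = real m * (real m + 1) / 2 * log 2 n"
  proof -
    have "(\<Sum>k\<le>m. real k) = real m * (real m + 1) / 2" for m
      by (induction m) (simp_all add: field_simps)
    then show ?thesis by (simp only: sum_distrib_right[symmetric])
  qed
  moreover have "(real d)\<^sup>2 * log 2 n \<le> 8 * (real m * (real m + 1) / 2 * log 2 n)"
  proof -
    \<comment> \<open>With \<open>d = 2 * m\<close> this reads
      \<open>4 * m^2 \<le> 4 * m * (m + 1)\<close>, whence the constant 8.\<close>
    have "(real d)\<^sup>2 \<le> 8 * (real m * (real m + 1) / 2)"
      by (simp add: d power2_eq_square algebra_simps)
    then show ?thesis using n mult_right_mono[of _ _ "log 2 n"] by fastforce
  qed
  ultimately show ?thesis by linarith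
qed

theorem theorem1:
  "\<exists>c C :: real. c > 0 \<and> C > 0 \<and>
     (\<forall>n d :: nat. n \<ge> 2 \<longrightarrow> d \<ge> 2 \<longrightarrow> even d \<longrightarrow>
       (\<exists>f :: ncpoly. nc_homogeneous n d f \<and>
          (\<forall>w. Poly_Mapping.lookup f w \<ge> 0) \<and>
          real (mono_abp_complexity n d f) \<ge> c * (real d)\<^sup>2 * log 2 (real n) \<and>
          real (abp_complexity n d f) \<le> C * (real d)\<^sup>2))"
proof (rule exI[of _ "1 / 8"], rule exI[of _ 4], intro conjI allI impI)
  fix n d :: nat
  assume n: "2 \<le> n" and d: "2 \<le> d" and even: "even d"
  let ?S = "weighted_sum (palindromic_weight n d) 0"
  obtain A :: "nat abp" where A: "is_abp n d A" "abp_size A \<le> 3 * d + 1"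
    and poly: "\<And>w. w \<in> words n d \<Longrightarrow> coeff (abp_poly A) w = (?S w)\<^sup>2"
    using ex_square_abp[of d n "palindromic_weight n d"] d by auto
  interpret A: valid_abp n d A by standard (rule A(1))
  let ?f = "abp_poly A"
  have hom: "nc_homogeneous n d ?f" by (rule A.nc_homogeneous_abp_poly)
  have nonneg: "0 \<le> coeff ?f w" for w
  proof (cases "w \<in> words n d")
    case False
    then have "coeff ?f w = 0" using hom unfolding nc_homogeneous_iff_coeff by blast
    then show ?thesis by simp
  qed (simp add: poly)
  have "\<exists>s. \<exists>B :: nat abp. is_abp n d B \<and> abp_monotone B \<and> abp_poly B = ?f \<and> abp_size B = s"
    using ex_monotone_abp[OF _ hom nonneg] d by auto
  \<comment> \<open>The minimum is attained, so the lower bound can be applied to an optimal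
    monotone ABP \<open>B\<close>.\<close>
  from LeastI_ex[OF this] obtain B :: "nat abp" where B: "is_abp n d B" "abp_monotone B"
    "abp_poly B = ?f" "abp_size B = mono_abp_complexity n d ?f"
    unfolding mono_abp_complexity_def by blast
  interpret B: monotone_abp n d B by standard (use B in auto)
  have "(real d)\<^sup>2 * log 2 n \<le> 8 * real (mono_abp_complexity n d ?f)"
    using B.size_ge[OF n even] poly B by simp
  moreover have "abp_complexity n d ?f \<le> abp_size A"
    unfolding abp_complexity_def using A by (intro Least_le) auto
  then have "abp_complexity n d ?f \<le> 4 * d ^ 2"
  proof -
    have "2 * d \<le> d * d" using d by simp
    then have "3 * d + 1 \<le> 4 * d ^ 2" using d unfolding power2_eq_square by linarith
    then show ?thesis using A(2) \<open>abp_complexity n d ?f \<le> abp_size A\<close> by linarith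
  qed
  then have "real (abp_complexity n d ?f) \<le> 4 * (real d)\<^sup>2"
    by (metis of_nat_le_iff of_nat_mult of_nat_numeral of_nat_power)
  ultimately show "\<exists>f :: ncpoly. nc_homogeneous n d f \<and>
      (\<forall>w. Poly_Mapping.lookup f w \<ge> 0) \<and>
      real (mono_abp_complexity n d f) \<ge> 1 / 8 * (real d)\<^sup>2 * log 2 (real n) \<and>
      real (abp_complexity n d f) \<le> 4 * (real d)\<^sup>2"
    using hom nonneg by (intro exI[of _ ?f]) auto
qed simp_all

end
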